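(* Let $L=J\cup J'\cup J''$ be a pairwise disjoint union of sets of propositional variables, and for every $K\subseteq L$ let $X_K=\{0,1\}^K$ and let $\mu_K:\mathcal{P}(X_K)\to\mathcal{P}(X_K)$ assign to each set of $K$-models its set of minimal elements with respect to some binary relation $\prec_K$ on $X_K$. Assume $(\mu*1)$: for all disjoint $K,K'\subseteq L$ and all $\Sigma\subseteq X_K$, $\Sigma'\subseteq X_{K'}$, $\mu_{K\cup K'}(\Sigma\times\Sigma')=\mu_K(\Sigma)\times\mu_{K'}(\Sigma')$. Then semantical interpolation of the form $\phi\mid\!\sim\alpha\mid\!\sim\psi$ holds: whenever $\phi$ is a classical propositional formula using only variables from $J'\cup J''$, $\psi$ is a classical propositional formula using only variables from $J\cup J'$, and $\mu_L(M(\phi))\subseteq M(\psi)$, there is a set $A\subseteq X_{J'}$ such that $$\mu_L(M(\phi))\subseteq X_J\times A\times X_{J''}\quad\text{and}\quad \mu_L(X_J\times A\times X_{J''})\subseteq M(\psi).$$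
   Context: $M(\phi)\subseteq X_L$ is the set of two-valued $L$-models of $\phi$. For disjoint $K,K'$, $X_{K\cup K'}$ is identified with $X_K\times X_{K'}$. For $X\subseteq X_K$, $\mu_K(X)=\{x\in X:\text{there is no }y\in X\text{ with }y\prec_K x\}$. The consequence relation is $\phi\mid\!\sim\psi$ iff $\mu_L(M(\phi))\subseteq M(\psi)$; it is extended to arbitrary sets of models in place of formulas in the same way. Interpolation is semantical: the interpolant is a set of models depending only on the common variables $J'$, i.e. of the form $X_J\times A\times X_{J''}$ with $A\subseteq X_{J'}$, which need not be the model set of any formula. *)

theory Defs
  imports Main "HOL-Library.FuncSet"
begin

datatype 'v fm =
    Atom 'v
  | Bot
  | Neg "'v fm"
  | Conj "'v fm" "'v fm"
  | Disj "'v fm" "'v fm"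
  | Impl "'v fm" "'v fm"

primrec vars :: "'v fm \<Rightarrow> 'v set" where
  "vars (Atom p) = {p}"
| "vars Bot = {}"
| "vars (Neg f) = vars f"
| "vars (Conj f g) = vars f \<union> vars g"
| "vars (Disj f g) = vars f \<union> vars g"
| "vars (Impl f g) = vars f \<union> vars g"

type_synonym 'v model = "'v \<Rightarrow> bool"

primrec sat :: "'v model \<Rightarrow> 'v fm \<Rightarrow> bool" where
  "sat x (Atom p) \<longleftrightarrow> x p"
| "sat x Bot \<longleftrightarrow> False"
| "sat x (Neg f) \<longleftrightarrow> \<not> sat x f"
| "sat x (Conj f g) \<longleftrightarrow> sat x f \<and> sat x g"
| "sat x (Disj f g) \<longleftrightarrow> sat x f \<or> sat x g"
| "sat x (Impl f g) \<longleftrightarrow> (sat x f \<longrightarrow> sat x g)"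

text \<open>The set \<open>{0,1}\<^sup>K\<close>. A model over \<open>K\<close> is a function that takes the fixed dummy value
  \<open>undefined\<close> outside \<open>K\<close>, so that models over \<open>K\<close> are determined by their values on \<open>K\<close>.\<close>

definition models :: "'v set \<Rightarrow> 'v model set" where
  "models K = (K \<rightarrow>\<^sub>E UNIV)"

text \<open>Only meaningful if \<open>vars f \<subseteq> K\<close>, because of the dummy value outside \<open>K\<close>.\<close>

definition Mod :: "'v set \<Rightarrow> 'v fm \<Rightarrow> 'v model set" where
  "Mod K f = {x \<in> models K. sat x f}"

text \<open>For disjoint \<open>K\<close> and \<open>K'\<close>, a model over \<open>K \<union> K'\<close> is identified with the pair of its
  restrictions (see \<open>bij_betw_split_model\<close>); \<open>model_prod K K' S S'\<close> is \<open>S \<times> S'\<close> read as a set of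
  models over \<open>K \<union> K'\<close>.\<close>

definition split_model :: "'v set \<Rightarrow> 'v set \<Rightarrow> 'v model \<Rightarrow> 'v model \<times> 'v model" where
  "split_model K K' x = (restrict x K, restrict x K')"

definition model_prod ::
  "'v set \<Rightarrow> 'v set \<Rightarrow> 'v model set \<Rightarrow> 'v model set \<Rightarrow> 'v model set" where
  "model_prod K K' S S' = {x \<in> models (K \<union> K'). split_model K K' x \<in> S \<times> S'}"

lemma bij_betw_split_model:
  assumes "K \<inter> K' = {}"
  shows "bij_betw (split_model K K') (models (K \<union> K')) (models K \<times> models K')"
  by (rule bij_betw_byWitness[where f' = "\<lambda>(y, z) p. if p \<in> K then y p else z p"])
    (use assms in \<open>auto simp: split_model_def models_def PiE_def extensional_def fun_eq_iff\<close>)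

text \<open>\<open>(y, x) \<in> prec K\<close> stands for \<open>y \<prec>\<^sub>K x\<close>; no property of the relations is required.\<close>

definition mu :: "('v set \<Rightarrow> 'v model rel) \<Rightarrow> 'v set \<Rightarrow> 'v model set \<Rightarrow> 'v model set" where
  "mu prec K S = {x \<in> S. \<not> (\<exists>y \<in> S. (y, x) \<in> prec K)}"

end

theory Submission
  imports Defs
begin

text \<open>
  Since \<open>\<phi>\<close> does not mention \<open>J\<close>, its model set is a product \<open>X\<^sub>J \<times> \<Sigma>\<close> with \<open>\<Sigma> \<subseteq> X\<^bsub>J' \<union> J''\<^esub>\<close>
  (\<open>Mod_eq_model_prod\<close>), and the product law gives \<open>\<mu>(M(\<phi>)) = \<mu>(X\<^sub>J) \<times> \<mu>(\<Sigma>)\<close>. The interpolant is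
  the projection \<open>A\<close> of \<open>\<mu>(M(\<phi>))\<close> to \<open>J'\<close>, so the first inclusion is immediate. For the second,
  applying the product law twice shows that a minimal element \<open>z\<close> of \<open>X\<^sub>J \<times> A \<times> X\<^bsub>J''\<^esub>\<close> has its
  \<open>J\<close>-part in \<open>\<mu>(X\<^sub>J)\<close> and its \<open>J'\<close>-part in \<open>\<mu>(A) \<subseteq> A\<close>. So some \<open>w \<in> \<mu>(M(\<phi>))\<close> agrees with \<open>z\<close> on
  \<open>J'\<close>. Replacing the \<open>J\<close>-part of \<open>w\<close> by that of \<open>z\<close> yields an element of
  \<open>\<mu>(X\<^sub>J) \<times> \<mu>(\<Sigma>) = \<mu>(M(\<phi>)) \<subseteq> M(\<psi>)\<close> that agrees with \<open>z\<close> on \<open>J \<union> J'\<close>, hence on all variables of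
  \<open>\<psi>\<close> (\<open>sat_cong\<close>), and therefore \<open>z \<in> M(\<psi>)\<close>.
\<close>

lemma sat_cong:
  assumes "\<And>p. p \<in> vars f \<Longrightarrow> x p = y p"
  shows "sat x f \<longleftrightarrow> sat y f"
  using assms by (induction f) auto

lemma restrict_in_models [simp]: "restrict x K \<in> models K"
  by (simp add: models_def)

lemma mu_subset: "mu prec K S \<subseteq> S"
  by (auto simp: mu_def)

lemma model_prod_iff:
  "x \<in> model_prod K K' S S' \<longleftrightarrow>
     x \<in> models (K \<union> K') \<and> restrict x K \<in> S \<and> restrict x K' \<in> S'"
  by (simp add: model_prod_def split_model_def)

lemma model_prod_subset_models: "model_prod K K' S S' \<subseteq> models (K \<union> K')"
  by (simp add: model_prod_def)

lemma sat_restrict: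
  assumes "vars f \<subseteq> K"
  shows "sat (restrict x K) f \<longleftrightarrow> sat x f"
  using assms by (intro sat_cong) auto

lemma Mod_eq_model_prod:
  assumes "vars f \<subseteq> K'"
  shows "Mod (K \<union> K') f = model_prod K K' (models K) (Mod K' f)"
  using assms by (auto simp: Mod_def model_prod_iff sat_restrict)

theorem proposition4p7:
  fixes L J J' J'' :: "'v set"
    and prec :: "'v set \<Rightarrow> 'v model rel"
    and \<phi> \<psi> :: "'v fm"
  assumes L: "L = J \<union> J' \<union> J''"
    and disjoint: "J \<inter> J' = {}" "J \<inter> J'' = {}" "J' \<inter> J'' = {}"
    and prec_on: "\<And>K. K \<subseteq> L \<Longrightarrow> prec K \<subseteq> models K \<times> models K"
    and mu_star_1: "\<And>K K' S S'. \<lbrakk>K \<subseteq> L; K' \<subseteq> L; K \<inter> K' = {}; S \<subseteq> models K; S' \<subseteq> models K'\<rbrakk>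
      \<Longrightarrow> mu prec (K \<union> K') (model_prod K K' S S') = model_prod K K' (mu prec K S) (mu prec K' S')"
    and vars_\<phi>: "vars \<phi> \<subseteq> J' \<union> J''"
    and vars_\<psi>: "vars \<psi> \<subseteq> J \<union> J'"
    and entails: "mu prec L (Mod L \<phi>) \<subseteq> Mod L \<psi>"
  shows "\<exists>A \<subseteq> models J'.
    mu prec L (Mod L \<phi>)
      \<subseteq> model_prod (J \<union> J') J'' (model_prod J J' (models J) A) (models J'') \<and>
    mu prec L (model_prod (J \<union> J') J'' (model_prod J J' (models J) A) (models J''))
      \<subseteq> Mod L \<psi>"
proof -
  define M where "M = mu prec L (Mod L \<phi>)"
  define A where "A = (\<lambda>x. restrict x J') ` M"
  let ?B = "model_prod J J' (models J) A"
  let ?C = "model_prod (J \<union> J') J'' ?B (models J'')"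

  have A_models: "A \<subseteq> models J'"
    by (auto simp: A_def)
  have L': "L = J \<union> (J' \<union> J'')"
    using L by auto
  have M_eq: "M = model_prod J (J' \<union> J'') (mu prec J (models J))
                    (mu prec (J' \<union> J'') (Mod (J' \<union> J'') \<phi>))"
    unfolding M_def L' Mod_eq_model_prod[OF vars_\<phi>]
    by (rule mu_star_1) (use disjoint in \<open>auto simp: L Mod_def\<close>)
  have M_models: "M \<subseteq> models L"
    using mu_subset[of prec L "Mod L \<phi>"] by (auto simp: M_def Mod_def)

  have "M \<subseteq> ?C"
  proof
    fix x assume "x \<in> M"
    moreover have "restrict (restrict x (J \<union> J')) J' = restrict x J'"
      by (simp add: Int_absorb1)
    ultimately show "x \<in> ?C"
      using M_models by (auto simp: model_prod_iff A_def L)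
  qed

  moreover have "mu prec L ?C \<subseteq> Mod L \<psi>"
  proof
    fix z assume z: "z \<in> mu prec L ?C"
    have "mu prec L ?C = model_prod (J \<union> J') J'' (mu prec (J \<union> J') ?B) (mu prec J'' (models J''))"
      unfolding L
      by (rule mu_star_1) (use disjoint in \<open>auto simp: L model_prod_subset_models\<close>)
    also have "mu prec (J \<union> J') ?B = model_prod J J' (mu prec J (models J)) (mu prec J' A)"
      by (rule mu_star_1) (use disjoint A_models in \<open>auto simp: L\<close>)
    finally have z_L: "z \<in> models L" and z_J: "restrict z J \<in> mu prec J (models J)"
      and z_J': "restrict z J' \<in> mu prec J' A"
      using z by (auto simp: model_prod_iff L Int_absorb1)
    from z_J' obtain w where w: "w \<in> M" and zw: "restrict z J' = restrict w J'"
      using mu_subset[of prec J' A] by (auto simp: A_def)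

    define u where "u = (\<lambda>p. if p \<in> J then z p else w p)"
    have u_J: "restrict u J = restrict z J"
      by (auto simp: u_def)
    have u_rest: "restrict u (J' \<union> J'') = restrict w (J' \<union> J'')"
      using disjoint by (auto simp: u_def restrict_def fun_eq_iff)
    have "u \<in> models (J \<union> (J' \<union> J''))"
      using w M_models by (auto simp: u_def models_def L PiE_def extensional_def)
    then have "u \<in> M"
      using w z_J unfolding M_eq model_prod_iff u_J u_rest by simp
    then have "sat u \<psi>"
      using entails by (auto simp: M_def Mod_def)
    moreover have "u p = z p" if "p \<in> vars \<psi>" for p
      using that vars_\<psi> fun_cong[OF zw, of p] by (auto simp: u_def)
    ultimately have "sat z \<psi>"
      using sat_cong[of \<psi> u z] by simp
    with z_L show "z \<in> Mod L \<psi>"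
      by (simp add: Mod_def)
  qed

  ultimately show ?thesis
    using A_models unfolding M_def by blast
qed

end
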